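(* Let $f:\mathbb{R}^n\to\mathbb{R}\cup\{\infty\}$ be lower semicontinuous with $\inf_{x\in\mathbb{R}^n}f(x)>-\infty$, and let $(x_k)_{k\ge0}$ be a sequence in $\mathbb{R}^n$ such that: (1) (sufficient decrease) there exists $\alpha>0$ such that $f(x_k)-f(x_{k+1})\ge\alpha\|x_{k+1}-x_k\|^2$ for all $k=0,1,\ldots$; and (2) at least one of the following holds: (2a) (relative error) there exists $\beta>0$ such that for each $k=0,1,\ldots$ there is $w_{k+1}\in\partial f(x_{k+1})$ with $\|w_{k+1}\|\le\beta\|x_{k+1}-x_k\|$; (2b) (modified relative error) there exists $\beta>0$ such that for each $k=0,1,\ldots$ there is $w_k\in\partial f(x_k)$ with $\|w_k\|\le\beta\|x_{k+1}-x_k\|$. Assume in addition that the set of stationary points $S:=(\partial f)^{-1}(0)=\{x : 0\in\partial f(x)\}$ is nonempty. Then: (i) If $(\partial f)^{-1}:\mathbb{R}^n\rightrightarrows\mathbb{R}^n$ is R-continuous at $0$, then $\mathbf{d}(x_k,S)\to0$ as $k\to\infty$. (ii) If the sequence $(x_k)$ is bounded and the graph of $(\partial f)^{-1}$ is closed at $0$, then $\mathbf{d}(x_k,S)\to0$ as $k\to\infty$.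
   Context: $\mathbf{d}(x,\Omega)=\inf_{y\in\Omega}\|x-y\|$. $\mathbb{B}$ is the closed unit ball and $\mathbb{B}(\bar x,\sigma)$ the closed ball with center $\bar x$ and radius $\sigma$. Subdifferential: $\mathrm{dom}\,f=\{x : f(x)<\infty\}$. For $x\in\mathrm{dom}\,f$, the regular subdifferential $\widehat\partial f(x)$ is the set of $v\in\mathbb{R}^n$ with $\liminf_{u\to x,\,u\neq x}\frac{f(u)-f(x)-\langle v,u-x\rangle}{\|u-x\|}\ge0$. For $\bar x\in\mathrm{dom}\,f$, the limiting (Mordukhovich) subdifferential $\partial f(\bar x)$ is the set of $v\in\mathbb{R}^n$ for which there exist $x_k\to\bar x$ with $f(x_k)\to f(\bar x)$ and $v_k\in\widehat\partial f(x_k)$ with $v_k\to v$. For $\bar x\notin\mathrm{dom}\,f$, $\partial f(\bar x)=\emptyset$. The inverse is $(\partial f)^{-1}(v)=\{x : v\in\partial f(x)\}$. R-continuity: a set-valued mapping $\mathcal{A}$ is R-continuous at $\bar x$ (with $\mathcal{A}(\bar x)\neq\emptyset$) if there exist $\sigma>0$ and a nondecreasing $\rho:[0,\infty)\to[0,\infty)$ with $\lim_{r\to0^+}\rho(r)=\rho(0)=0$ such that $\mathcal{A}(x)\subset\mathcal{A}(\bar x)+\rho(\|x-\bar x\|)\mathbb{B}$ for all $x\in\mathbb{B}(\bar x,\sigma)$. Closed graph at a point: the graph of $\mathcal{A}$ is closed at $\bar x$ (with $\mathcal{A}(\bar x)\neq\emptyset$) if whenever $z_k\to\bar x$, $y_k\in\mathcal{A}(z_k)$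 and $y_k\to y$, one has $y\in\mathcal{A}(\bar x)$. *)

theory Defs
  imports "HOL-Analysis.Analysis"
begin

text \<open>
  Functions into the reals extended by plus infinity are rendered as \<^typ>\<open>ereal\<close>-valued
  functions; theorems about them exclude the value minus infinity by hypothesis.
\<close>

text \<open>
  \<^term>\<open>at x\<close> is the punctured neighbourhood filter, so the value at \<^term>\<open>x\<close> itself does
  not enter the limit inferior.
\<close>

definition lower_semicontinuous :: "('a::topological_space \<Rightarrow> ereal) \<Rightarrow> bool" where
  "lower_semicontinuous f \<longleftrightarrow> (\<forall>x. f x \<le> Liminf (at x) f)"

definition dom_ext :: "('a \<Rightarrow> ereal) \<Rightarrow> 'a set" where
  "dom_ext f = {x. f x < \<infinity>}"

definition regular_subdiff :: "('a::euclidean_space \<Rightarrow> ereal) \<Rightarrow> 'a \<Rightarrow> 'a set" where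
  "regular_subdiff f x =
     {v. x \<in> dom_ext f \<and>
         0 \<le> Liminf (at x)
               (\<lambda>u. (f u - f x - ereal (v \<bullet> (u - x))) / ereal (norm (u - x)))}"

definition limiting_subdiff :: "('a::euclidean_space \<Rightarrow> ereal) \<Rightarrow> 'a \<Rightarrow> 'a set" where
  "limiting_subdiff f x =
     {v. x \<in> dom_ext f \<and>
         (\<exists>X V. X \<longlonglongrightarrow> x \<and> (\<lambda>k. f (X k)) \<longlonglongrightarrow> f x \<and>
                (\<forall>k. V k \<in> regular_subdiff f (X k)) \<and> V \<longlonglongrightarrow> v)}"

definition set_valued_inverse :: "('a \<Rightarrow> 'b set) \<Rightarrow> 'b \<Rightarrow> 'a set" where
  "set_valued_inverse A y = {x. y \<in> A x}"

text \<open>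
  The modulus is a total function on the reals, but only its restriction to the nonnegative
  reals is constrained and used. The \<open>+\<close> between sets is the Minkowski sum.
\<close>

definition R_continuous_at ::
  "('a::real_normed_vector \<Rightarrow> 'b::real_normed_vector set) \<Rightarrow> 'a \<Rightarrow> bool" where
  "R_continuous_at A x0 \<longleftrightarrow>
     A x0 \<noteq> {} \<and>
     (\<exists>\<sigma>>0. \<exists>\<rho>::real \<Rightarrow> real.
        (\<forall>r\<ge>0. 0 \<le> \<rho> r) \<and> mono_on {0..} \<rho> \<and> \<rho> 0 = 0 \<and> (\<rho> \<longlongrightarrow> 0) (at_right 0) \<and>
        (\<forall>x\<in>cball x0 \<sigma>. A x \<subseteq> A x0 + (\<lambda>b. \<rho> (norm (x - x0)) *\<^sub>R b) ` cball 0 1))"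

definition closed_graph_at ::
  "('a::topological_space \<Rightarrow> 'b::topological_space set) \<Rightarrow> 'a \<Rightarrow> bool" where
  "closed_graph_at A x0 \<longleftrightarrow>
     A x0 \<noteq> {} \<and>
     (\<forall>z y l. z \<longlonglongrightarrow> x0 \<and> (\<forall>k. y k \<in> A (z k)) \<and> y \<longlonglongrightarrow> l \<longrightarrow> l \<in> A x0)"

end

theory Submission
  imports Defs
begin

text \<open>
  Sufficient decrease makes the values \<open>f (x (Suc k))\<close> a decreasing real sequence that is
  bounded below, hence convergent; the step lengths are dominated by its consecutive differences
  and therefore tend to zero (\<open>sufficient_decrease_steps_tendsto_0\<close>). Either relative error
  condition then yields subgradients \<open>w k\<close> at the iterates \<open>x (Suc k)\<close> with \<open>w k \<longlonglongrightarrow> 0\<close>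
  (\<open>vanishing_subgradients\<close>). In terms of the inverse subdifferential \<open>A\<close> this says that
  \<open>x (Suc k) \<in> A (w k)\<close>, while \<open>S = A 0\<close>.

  What remains is a statement about set-valued maps only: if \<open>w k \<longlonglongrightarrow> y0\<close> and
  \<open>x k \<in> A (w k)\<close>, then \<open>x k\<close> approaches \<open>A y0\<close>. R-continuity gives this directly, as the modulus
  evaluated at \<open>norm (w k - y0)\<close> bounds the distance. Under a closed graph, every cluster point of
  the sequence lies in \<open>A y0\<close>, and boundedness turns this into convergence of the distances.
\<close>

section \<open>Approaching the value of a set-valued map\<close>

lemma R_continuous_at_infdist_tendsto_0:
  assumes A: "R_continuous_at A y0"
    and w: "w \<longlonglongrightarrow> y0"
    and x: "\<And>k. x k \<in> A (w k)"
  shows "(\<lambda>k. infdist (x k) (A y0)) \<longlonglongrightarrow> 0"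
proof -
  from A obtain \<sigma> \<rho> where "\<sigma> > 0"
    and nonneg: "\<And>r. r \<ge> 0 \<Longrightarrow> 0 \<le> \<rho> r" and "\<rho> 0 = 0" and lim: "(\<rho> \<longlongrightarrow> 0) (at_right 0)"
    and sub: "\<And>y. y \<in> cball y0 \<sigma> \<Longrightarrow> A y \<subseteq> A y0 + (\<lambda>b. \<rho> (norm (y - y0)) *\<^sub>R b) ` cball 0 1"
    unfolding R_continuous_at_def by blast
  \<comment> \<open>\<open>w k\<close> may equal \<open>y0\<close>, so the right limit has to be combined with the value \<open>\<rho> 0 = 0\<close>.\<close>
  have "continuous (at 0 within {0..}) \<rho>"
    using lim \<open>\<rho> 0 = 0\<close>
    by (simp add: continuous_within at_within_Ici_at_right)
  moreover have "(\<lambda>k. norm (w k - y0)) \<longlonglongrightarrow> 0"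
    using w by (simp add: LIM_zero tendsto_norm_zero)
  ultimately have bound: "(\<lambda>k. \<rho> (norm (w k - y0))) \<longlonglongrightarrow> 0"
    using continuous_within_tendsto_compose'[of 0 "{0..}" \<rho> "\<lambda>k. norm (w k - y0)" sequentially] \<open>\<rho> 0 = 0\<close>
    by simp
  have "infdist (x k) (A y0) \<le> \<rho> (norm (w k - y0))" if "dist (w k) y0 < \<sigma>" for k
  proof -
    have "w k \<in> cball y0 \<sigma>"
      using that by (simp add: dist_commute)
    then obtain s b where s: "s \<in> A y0" and b: "norm b \<le> 1"
      and xk: "x k = s + \<rho> (norm (w k - y0)) *\<^sub>R b"
      using sub x by (force elim!: set_plus_elim)
    have "infdist (x k) (A y0) \<le> dist (x k) s"
      using s by (rule infdist_le)
    also have "\<dots> = \<rho> (norm (w k - y0)) * norm b"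
      by (simp add: xk dist_norm nonneg)
    also have "\<dots> \<le> \<rho> (norm (w k - y0))"
      using b by (simp add: nonneg mult_left_le)
    finally show ?thesis .
  qed
  moreover have "\<forall>\<^sub>F k in sequentially. dist (w k) y0 < \<sigma>"
    using w \<open>\<sigma> > 0\<close> by (rule tendstoD)
  ultimately have "\<forall>\<^sub>F k in sequentially. infdist (x k) (A y0) \<le> \<rho> (norm (w k - y0))"
    by (auto elim: eventually_mono)
  then show ?thesis
    by (intro tendsto_sandwich[OF _ _ tendsto_const bound]) (auto simp: infdist_nonneg)
qed

text \<open>
  Otherwise some subsequence keeps a positive distance from \<open>A y0\<close>; by compactness it clusters, and
  the closed graph places the cluster point in \<open>A y0\<close>.
\<close>

lemma closed_graph_at_infdist_tendsto_0:
  fixes x :: "nat \<Rightarrow> 'b::heine_borel"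
  assumes A: "closed_graph_at A y0"
    and w: "w \<longlonglongrightarrow> y0"
    and x: "\<And>k. x k \<in> A (w k)"
    and bdd: "bounded (range x)"
  shows "(\<lambda>k. infdist (x k) (A y0)) \<longlonglongrightarrow> 0"
proof (rule ccontr)
  assume "\<not> ?thesis"
  then obtain \<epsilon> where "\<epsilon> > 0" and "\<And>N. \<exists>k\<ge>N. \<epsilon> \<le> infdist (x k) (A y0)"
    by (auto simp: LIMSEQ_def infdist_nonneg not_less)
  then have "infinite {k. \<epsilon> \<le> infdist (x k) (A y0)}"
    by (auto simp: infinite_nat_iff_unbounded_le)
  from infinite_enumerate[OF this] obtain r :: "nat \<Rightarrow> nat" where r: "strict_mono r"
    and far: "\<And>k. \<epsilon> \<le> infdist (x (r k)) (A y0)"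
    by blast
  have "bounded (range (x \<circ> r))"
    using bdd by (rule bounded_subset) auto
  then obtain l s where s: "strict_mono s" and lim: "(x \<circ> r \<circ> s) \<longlonglongrightarrow> l"
    using bounded_imp_convergent_subsequence by blast
  have "(w \<circ> (r \<circ> s)) \<longlonglongrightarrow> y0"
    using w r s by (intro LIMSEQ_subseq_LIMSEQ strict_mono_o)
  moreover have "\<forall>k. (x \<circ> r \<circ> s) k \<in> A ((w \<circ> (r \<circ> s)) k)"
    by (simp add: x)
  ultimately have l: "l \<in> A y0"
    using A lim unfolding closed_graph_at_def by blast
  have "(\<lambda>k. infdist ((x \<circ> r \<circ> s) k) (A y0)) \<longlonglongrightarrow> infdist l (A y0)"
    using lim by (rule tendsto_infdist)
  then have "\<epsilon> \<le> infdist l (A y0)"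
    by (rule LIMSEQ_le_const) (use far in auto)
  then show False
    using l \<open>\<epsilon> > 0\<close> by simp
qed

section \<open>Descent sequences\<close>

lemma sufficient_decrease_steps_tendsto_0:
  fixes a d :: "nat \<Rightarrow> real"
  assumes "\<alpha> > 0"
    and bdd: "\<And>k. m \<le> a k"
    and dec: "\<And>k. \<alpha> * (d k)\<^sup>2 \<le> a k - a (Suc k)"
  shows "d \<longlonglongrightarrow> 0"
proof -
  have "a (Suc k) \<le> a k" for k
    using dec[of k] zero_le_power2[of "d k"] \<open>\<alpha> > 0\<close>
    by (smt (verit) mult_nonneg_nonneg)
  then have "decseq a"
    by (rule decseq_SucI)
  then obtain L where L: "a \<longlonglongrightarrow> L"
    using decseq_convergent bdd by blast
  have "(\<lambda>k. a k - a (Suc k)) \<longlonglongrightarrow> L - L"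
    using L LIMSEQ_Suc[OF L] by (rule tendsto_diff)
  then have gaps: "(\<lambda>k. (a k - a (Suc k)) / \<alpha>) \<longlonglongrightarrow> 0"
    by (simp add: tendsto_divide_zero)
  have "(d k)\<^sup>2 \<le> (a k - a (Suc k)) / \<alpha>" for k
    using dec[of k] \<open>\<alpha> > 0\<close> by (simp add: pos_le_divide_eq mult.commute)
  then have "(\<lambda>k. (d k)\<^sup>2) \<longlonglongrightarrow> 0"
    by (intro Lim_null_comparison[OF _ gaps]) simp
  then show ?thesis
    by simp
qed

lemma limiting_subdiff_imp_dom_ext:
  "w \<in> limiting_subdiff f x \<Longrightarrow> x \<in> dom_ext f"
  by (simp add: limiting_subdiff_def)

text \<open>
  The starting point may lie outside the domain of \<open>f\<close>, in which case the first decrease is infinite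
  and bounds nothing; the real-valued argument therefore starts with the values at \<open>x (Suc k)\<close>.
\<close>

lemma iterate_steps_tendsto_0:
  fixes f :: "'a::real_normed_vector \<Rightarrow> ereal"
  assumes nmi: "\<And>y. f y \<noteq> -\<infinity>"
    and inf: "(INF y. f y) > -\<infinity>"
    and "\<alpha> > 0"
    and dec: "\<And>k. f (x k) - f (x (Suc k)) \<ge> ereal (\<alpha> * (norm (x (Suc k) - x k))\<^sup>2)"
    and dom: "\<And>k. x (Suc k) \<in> dom_ext f"
  shows "(\<lambda>k. norm (x (Suc k) - x k)) \<longlonglongrightarrow> 0"
proof -
  define a where "a k = real_of_ereal (f (x (Suc k)))" for k
  have a: "f (x (Suc k)) = ereal (a k)" for k
    using nmi[of "x (Suc k)"] dom[of k] unfolding a_def dom_ext_def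
    by (cases "f (x (Suc k))") auto
  obtain m where "ereal m < (INF y. f y)"
    using inf ereal_dense2 by blast
  then have "ereal m \<le> f y" for y
    by (meson INF_lower UNIV_I less_imp_le order_trans)
  then have "m \<le> a k" for k
    by (metis a ereal_less_eq(3))
  moreover have "\<alpha> * (norm (x (Suc (Suc k)) - x (Suc k)))\<^sup>2 \<le> a k - a (Suc k)" for k
    using dec[of "Suc k"] by (simp add: a)
  ultimately have "(\<lambda>k. norm (x (Suc (Suc k)) - x (Suc k))) \<longlonglongrightarrow> 0"
    using \<open>\<alpha> > 0\<close> by (rule sufficient_decrease_steps_tendsto_0[rotated])
  then show ?thesis
    by (rule LIMSEQ_imp_Suc)
qed

text \<open>
  The two error conditions differ by an index shift only. Both provide subgradients at
  \<open>x (Suc k)\<close>, bounded by the step into that point or by the step out of it; both steps vanish.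
\<close>

lemma vanishing_subgradients:
  fixes f :: "'a::euclidean_space \<Rightarrow> ereal"
  assumes nmi: "\<And>y. f y \<noteq> -\<infinity>"
    and inf: "(INF y. f y) > -\<infinity>"
    and "\<alpha> > 0"
    and dec: "\<And>k. f (x k) - f (x (Suc k)) \<ge> ereal (\<alpha> * (norm (x (Suc k) - x k))\<^sup>2)"
    and err:
      "(\<exists>\<beta>>0. \<forall>k. \<exists>w \<in> limiting_subdiff f (x (Suc k)). norm w \<le> \<beta> * norm (x (Suc k) - x k)) \<or>
       (\<exists>\<beta>>0. \<forall>k. \<exists>w \<in> limiting_subdiff f (x k). norm w \<le> \<beta> * norm (x (Suc k) - x k))"
  obtains w where "\<And>k. w k \<in> limiting_subdiff f (x (Suc k))" and "w \<longlonglongrightarrow> 0"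
proof -
  have "x (Suc k) \<in> dom_ext f" for k
    using err limiting_subdiff_imp_dom_ext by blast
  then have steps: "(\<lambda>k. norm (x (Suc k) - x k)) \<longlonglongrightarrow> 0"
    using iterate_steps_tendsto_0[of f \<alpha> x, OF nmi inf \<open>\<alpha> > 0\<close> dec] by blast
  obtain \<beta> w p where w: "\<And>k. w k \<in> limiting_subdiff f (x (Suc k))"
    and bound: "\<And>k. norm (w k) \<le> \<beta> * p k" and p: "p \<longlonglongrightarrow> 0"
    using err
  proof
    assume "\<exists>\<beta>>0. \<forall>k. \<exists>w \<in> limiting_subdiff f (x (Suc k)). norm w \<le> \<beta> * norm (x (Suc k) - x k)"
    then show ?thesis
      using that[OF _ _ steps] by metis
  next
    assume "\<exists>\<beta>>0. \<forall>k. \<exists>w \<in> limiting_subdiff f (x k). norm w \<le> \<beta> * norm (x (Suc k) - x k)"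
    then obtain \<beta> where
      "\<forall>k. \<exists>w \<in> limiting_subdiff f (x (Suc k)). norm w \<le> \<beta> * norm (x (Suc (Suc k)) - x (Suc k))"
      by blast
    then show ?thesis
      using that[OF _ _ LIMSEQ_Suc[OF steps]] by metis
  qed
  have "w \<longlonglongrightarrow> 0"
    using bound by (intro Lim_null_comparison[OF _ tendsto_mult_right_zero[OF p, of \<beta>]]) simp
  with w show ?thesis
    by (rule that)
qed

theorem theorem8:
  fixes f :: "real ^ 'n \<Rightarrow> ereal"
    and x :: "nat \<Rightarrow> real ^ 'n"
    and S :: "(real ^ 'n) set"
  assumes no_minus_infinity: "\<And>y. f y \<noteq> -\<infinity>"
    and lsc: "lower_semicontinuous f"
    and bounded_below: "(INF y. f y) > -\<infinity>"
    and sufficient_decrease: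
      "\<exists>\<alpha>>0. \<forall>k. f (x k) - f (x (Suc k)) \<ge> ereal (\<alpha> * (norm (x (Suc k) - x k))\<^sup>2)"
    and relative_error:
      "(\<exists>\<beta>>0. \<forall>k. \<exists>w \<in> limiting_subdiff f (x (Suc k)). norm w \<le> \<beta> * norm (x (Suc k) - x k)) \<or>
       (\<exists>\<beta>>0. \<forall>k. \<exists>w \<in> limiting_subdiff f (x k). norm w \<le> \<beta> * norm (x (Suc k) - x k))"
    and S_def: "S = set_valued_inverse (limiting_subdiff f) 0"
    and S_nonempty: "S \<noteq> {}"
  shows "(R_continuous_at (set_valued_inverse (limiting_subdiff f)) 0 \<longrightarrow>
            (\<lambda>k. infdist (x k) S) \<longlonglongrightarrow> 0) \<and>
         (bounded (range x) \<and> closed_graph_at (set_valued_inverse (limiting_subdiff f)) 0 \<longrightarrow>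
            (\<lambda>k. infdist (x k) S) \<longlonglongrightarrow> 0)"
proof -
  let ?A = "set_valued_inverse (limiting_subdiff f)"
  obtain w where "\<And>k. w k \<in> limiting_subdiff f (x (Suc k))" and w: "w \<longlonglongrightarrow> 0"
    using sufficient_decrease vanishing_subgradients[OF no_minus_infinity bounded_below _ _ relative_error]
    by metis
  then have x: "x (Suc k) \<in> ?A (w k)" for k
    by (simp add: set_valued_inverse_def)
  have "(\<lambda>k. infdist (x (Suc k)) S) \<longlonglongrightarrow> 0" if "R_continuous_at ?A 0"
    unfolding S_def using that w x by (rule R_continuous_at_infdist_tendsto_0)
  moreover have "(\<lambda>k. infdist (x (Suc k)) S) \<longlonglongrightarrow> 0"
    if "bounded (range x)" and "closed_graph_at ?A 0"
  proof -
    have "bounded (range (\<lambda>k. x (Suc k)))"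
      using \<open>bounded (range x)\<close> by (rule bounded_subset) auto
    then show ?thesis
      unfolding S_def using closed_graph_at_infdist_tendsto_0[OF that(2) w x] by blast
  qed
  ultimately show ?thesis
    using LIMSEQ_imp_Suc[of "\<lambda>k. infdist (x k) S" 0] by blast
qed

end
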